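(* Let $\alpha\in[0,2)$ and let $S$ be a subordinator with Laplace exponent $\phi$ such that $$\lim_{\lambda\to+\infty}\frac{\phi'(\lambda x)}{\phi'(\lambda)}=x^{\frac{\alpha}{2}-1}\quad\text{for every }x>0,$$ and such that the Lévy measure of $S$ is infinite and has a decreasing density $\mu$ on $(0,\infty)$. Then $$\mu(t)\asymp t^{-2}\phi'(t^{-1}),\quad t\to0+ .$$
   Context: A subordinator is a Lévy process $S$ in $\mathbb{R}$ with $S_0=0$ and values in $[0,\infty)$; its Laplace exponent $\phi$ is given by $\mathbb{E}e^{-\lambda S_t}=e^{-t\phi(\lambda)}$, $\lambda>0$, and has the form $\phi(\lambda)=\gamma\lambda+\int_{(0,\infty)}(1-e^{-\lambda t})\,\mu(dt)$ with $\gamma\ge0$ and Lévy measure $\mu$, $\int_{(0,\infty)}(1\wedge t)\,\mu(dt)<\infty$. When the Lévy measure has a density it is also denoted $\mu$, i.e. $\mu(dt)=\mu(t)\,dt$. "Decreasing" is meant in the non-strict sense. The notation $f(t)\asymp g(t)$, $t\to0+$, means that $f(t)/g(t)$ stays between two positive constants for all sufficiently small $t>0$. *)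

theory Defs
  imports "HOL-Probability.Probability"
begin

text \<open>
  Time runs through \<open>[0, \<infinity>)\<close>; the values \<open>X t\<close> for \<open>t < 0\<close> are irrelevant.
\<close>

locale levy_process = prob_space M for M :: "'a measure" +
  fixes X :: "real \<Rightarrow> 'a \<Rightarrow> real"
  assumes random_variable_X: "\<And>t. t \<ge> 0 \<Longrightarrow> random_variable borel (X t)"
    and start_at_0: "AE \<omega> in M. X 0 \<omega> = 0"
    and independent_increments:
      "\<And>(n::nat) t. \<lbrakk>0 \<le> t 0; \<forall>i<n. t i < t (Suc i)\<rbrakk> \<Longrightarrow>
         indep_vars (\<lambda>_. borel) (\<lambda>i \<omega>. X (t (Suc i)) \<omega> - X (t i) \<omega>) {..<n}"
    and stationary_increments:
      "\<And>s t. \<lbrakk>0 \<le> s; 0 \<le> t\<rbrakk> \<Longrightarrow>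
         distr M borel (\<lambda>\<omega>. X (s + t) \<omega> - X s \<omega>) = distr M borel (X t)"
    and cadlag_paths:
      "AE \<omega> in M. (\<forall>t\<ge>0. ((\<lambda>s. X s \<omega>) \<longlongrightarrow> X t \<omega>) (at_right t)) \<and>
                  (\<forall>t>0. \<exists>l. ((\<lambda>s. X s \<omega>) \<longlongrightarrow> l) (at_left t))"

locale subordinator = levy_process +
  assumes nonneg_values: "AE \<omega> in M. \<forall>t\<ge>0. X t \<omega> \<ge> 0"

text \<open>Only the values of \<open>\<phi>\<close> on \<open>(0, \<infinity>)\<close> are constrained.\<close>

definition is_laplace_exponent ::
    "'a measure \<Rightarrow> (real \<Rightarrow> 'a \<Rightarrow> real) \<Rightarrow> (real \<Rightarrow> real) \<Rightarrow> bool" where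
  "is_laplace_exponent M S \<phi> \<longleftrightarrow>
     (\<forall>l>0. \<forall>t\<ge>0. (LINT \<omega>|M. exp (- l * S t \<omega>)) = exp (- t * \<phi> l))"

text \<open>
  The Levy measure of a subordinator lives on \<open>(0, \<infinity>)\<close>; it is encoded as a Borel measure on
  the real line that gives no mass to the complement. The integrability condition also makes the
  Bochner integral in the representation of the Laplace exponent a genuine one.
\<close>

definition subordinator_levy_measure_of ::
    "'a measure \<Rightarrow> (real \<Rightarrow> 'a \<Rightarrow> real) \<Rightarrow> real measure \<Rightarrow> bool" where
  "subordinator_levy_measure_of M S \<nu> \<longleftrightarrow>
     sets \<nu> = sets borel \<and> emeasure \<nu> {..0} = 0 \<and>
     (\<integral>\<^sup>+t. ennreal (min 1 t) \<partial>\<nu>) < \<infinity> \<and>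
     (\<exists>\<gamma>\<ge>0. is_laplace_exponent M S (\<lambda>l. \<gamma> * l + (LINT t|\<nu>. 1 - exp (- l * t))))"

end

theory Submission
  imports Defs
begin

text \<open>
  Write \<open>D = \<phi>'\<close>, so that \<open>D l = \<gamma> + \<integral> t exp (- l t) \<mu>(t) dt\<close>. As \<open>\<mu>\<close> is decreasing, restricting
  the integral to \<open>[s/2, s]\<close> with \<open>l = 1/s\<close> gives \<open>\<mu>(s) \<le> 4 e s\<^sup>-\<^sup>2 D(1/s)\<close>. Conversely, splitting the
  integral at \<open>r\<close> gives \<open>D l \<le> e D(1/r) + \<mu>(r) / l\<^sup>2\<close>. With \<open>r = 1/(l x)\<close> and \<open>x\<close> so large that
  \<open>e (x powr (\<alpha>/2 - 1)) < 1/2\<close>, the first term is eventually at most \<open>D l / 2\<close>, which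
  leaves \<open>\<mu>(r) \<ge> l\<^sup>2 D l / 2 \<ge> l\<^sup>2 D(1/r) / 2\<close>.
\<close>

section \<open>Elementary exponential bounds\<close>

text \<open>The tangent line bound \<open>1 + u \<le> exp u\<close> at \<open>u = a - b\<close>,
  scaled by \<open>exp (- a)\<close>.\<close>

lemma exp_minus_diff_le: "exp (- a) - exp (- b) \<le> exp (- a) * (b - a)" for a b :: real
proof -
  have "1 - (b - a) \<le> exp (- (b - a))"
    using exp_ge_add_one_self[of "- (b - a)"] by linarith
  then have "exp (- a) * (1 - (b - a)) \<le> exp (- a) * exp (- (b - a))"
    by (intro mult_left_mono) auto
  also have "\<dots> = exp (- b)"
    by (simp flip: exp_add)
  finally show ?thesis
    by (simp add: algebra_simps)
qed

text \<open>Compares the differentiated integrand with \<open>min 1 t\<close>, the function that a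
  Levy measure integrates. Up to 1 the exponential is at most 1; beyond 1,
  \<open>k * t \<le> exp (k * t)\<close> gives the bound \<open>1 / k\<close>.\<close>

lemma times_exp_minus_le:
  fixes k t :: real
  assumes "k > 0" "t > 0"
  shows "t * exp (- (k * t)) \<le> (1 + 1 / k) * min 1 t"
proof (cases "t \<le> 1")
  case True
  have "t * exp (- (k * t)) \<le> t * 1"
    using assms by (intro mult_left_mono) auto
  also have "\<dots> \<le> (1 + 1 / k) * t"
    using assms by (simp add: field_simps)
  finally show ?thesis
    using True by simp
next
  case False
  have "k * t \<le> exp (k * t)"
    using exp_ge_add_one_self[of "k * t"] by linarith
  then have "t * exp (- (k * t)) \<le> 1 / k"
    using assms by (simp add: exp_minus field_simps)
  then show ?thesis
    using False by (simp add: min_def)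
qed

text \<open>Supplies a dominating function independent of \<open>y\<close>. By the tangent bound the
  quotient is at most \<open>t * exp (- (a * t))\<close> with \<open>a\<close> the smaller of the
  two points, and \<open>a > k\<close>.\<close>

lemma exp_minus_quotient_bound:
  fixes k l y t :: real
  assumes "k > 0" "t > 0" "k < l" "k < y" "y \<noteq> l"
  shows "\<bar>((1 - exp (- y * t)) - (1 - exp (- l * t))) / (y - l)\<bar> \<le> (1 + 1 / k) * min 1 t"
proof -
  \<comment> \<open>The quotient is symmetric in its two points, so the ordered case
    suffices.\<close>
  have *: "\<bar>((1 - exp (- b * t)) - (1 - exp (- a * t))) / (b - a)\<bar> \<le> (1 + 1 / k) * min 1 t"
    if "k < a" "a < b" for a b
  proof -
    have "exp (- (b * t)) \<le> exp (- (a * t))"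
      using that assms by simp
    then have "\<bar>((1 - exp (- b * t)) - (1 - exp (- a * t))) / (b - a)\<bar>
        = (exp (- (a * t)) - exp (- (b * t))) / (b - a)"
      using that by simp
    also have "\<dots> \<le> t * exp (- (a * t))"
      using exp_minus_diff_le[of "a * t" "b * t"] that by (simp add: field_simps)
    also have "\<dots> \<le> t * exp (- (k * t))"
      using that assms by simp
    also have "\<dots> \<le> (1 + 1 / k) * min 1 t"
      using assms by (intro times_exp_minus_le) auto
    finally show ?thesis .
  qed
  show ?thesis
  proof (cases "l < y")
    case True
    then show ?thesis using *[of l y] assms by simp
  next
    case False
    then have "y < l" using assms by simp
    moreover have "((1 - exp (- y * t)) - (1 - exp (- l * t))) / (y - l)
        = ((1 - exp (- l * t)) - (1 - exp (- y * t))) / (l - y)"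
      using \<open>y < l\<close> by (simp add: field_simps)
    ultimately show ?thesis using *[of y l] assms by metis
  qed
qed

section \<open>Differentiating the Levy integral\<close>

context
  fixes \<nu> :: "real measure"
  assumes sets_\<nu>: "sets \<nu> = sets borel"
    and null: "emeasure \<nu> {..0} = 0"
    and min_fin: "(\<integral>\<^sup>+t. ennreal (min 1 t) \<partial>\<nu>) < \<infinity>"
begin

lemma AE_levy_pos: "AE t in \<nu>. t > 0"
proof (rule AE_I)
  show "{t \<in> space \<nu>. \<not> t > 0} \<subseteq> {..0}" by auto
qed (use null sets_\<nu> in auto)

lemma integrable_levy:
  assumes "f \<in> borel_measurable borel" "\<And>t. t > 0 \<Longrightarrow> \<bar>f t\<bar> \<le> C * min 1 t"
  shows "integrable \<nu> f"
proof (rule Bochner_Integration.integrable_bound)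
  note [measurable_cong] = sets_\<nu>
  \<comment> \<open>\<open>ennreal\<close> cuts the negative values of \<open>min 1 t\<close> to 0;
    as \<open>{..0}\<close> is a null set, finiteness of the nonnegative integral still gives
    integrability.\<close>
  have "integrable \<nu> (\<lambda>t. min 1 t)"
    using min_fin AE_levy_pos by (intro integrableI_nonneg) auto
  then show "integrable \<nu> (\<lambda>t. C * min 1 t)" by simp
  show "f \<in> borel_measurable \<nu>" using assms(1) by measurable
  show "AE t in \<nu>. norm (f t) \<le> norm (C * min 1 t)"
    using AE_levy_pos assms(2) by (auto elim!: eventually_mono intro: order_trans[OF _ abs_ge_self])
qed

lemma integrable_levy_times_exp:
  assumes "l > 0"
  shows "integrable \<nu> (\<lambda>t. t * exp (- l * t))"
  using assms times_exp_minus_le[of l]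
  by (intro integrable_levy[where C = "1 + 1 / l"]) auto

text \<open>The integrand is at most 1 and at most \<open>l * t\<close>, so \<open>1 + l\<close>
  serves as the constant in both regimes.\<close>

lemma integrable_levy_one_minus_exp:
  assumes "l > 0"
  shows "integrable \<nu> (\<lambda>t. 1 - exp (- l * t))"
proof (rule integrable_levy[where C = "1 + l"])
  fix t :: real assume t: "t > 0"
  have 1: "1 - exp (- l * t) \<le> l * t"
    using exp_minus_diff_le[of 0 "l * t"] by simp
  have 2: "0 \<le> 1 - exp (- l * t)" "1 - exp (- l * t) \<le> 1"
    using t assms by auto
  have "l * t \<le> (1 + l) * t"
    using t by (intro mult_right_mono) auto
  with 1 have "1 - exp (- l * t) \<le> (1 + l) * t" by (rule order_trans)
  moreover have "1 - exp (- l * t) \<le> (1 + l) * 1"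
    by (rule order_trans[OF 2(2)]) (use assms in simp)
  ultimately show "\<bar>1 - exp (- l * t)\<bar> \<le> (1 + l) * min 1 t"
    unfolding abs_of_nonneg[OF 2(1)] by (simp only: min_def split: if_split) simp
qed auto

text \<open>Dominated convergence for the difference quotients along sequences tending to
  \<open>l\<close>.\<close>

lemma levy_integral_has_derivative:
  assumes "l > 0"
  shows "((\<lambda>l. LINT t|\<nu>. 1 - exp (- l * t)) has_field_derivative
           (LINT t|\<nu>. t * exp (- l * t))) (at l)"
proof -
  note [measurable_cong] = sets_\<nu>
  define F where "F = (\<lambda>l. LINT t|\<nu>. 1 - exp (- l * t))"
  \<comment> \<open>Keeping \<open>y\<close> above \<open>l/2\<close> allows the quotient bound with
    \<open>k = l/2\<close>; this open neighbourhood of \<open>l\<close> does not affect the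
    limit.\<close>
  have "((\<lambda>y. (F y - F l) / (y - l)) \<longlongrightarrow> (LINT t|\<nu>. t * exp (- l * t))) (at l within {l/2<..})"
    unfolding tendsto_at_iff_sequentially
  proof (intro allI impI)
    fix X :: "nat \<Rightarrow> real"
    assume X: "\<forall>i. X i \<in> {l / 2<..} - {l}" "X \<longlonglongrightarrow> l"
    have eq: "(LINT t|\<nu>. ((1 - exp (- X i * t)) - (1 - exp (- l * t))) / (X i - l))
        = (F (X i) - F l) / (X i - l)" for i
    proof -
      have "X i > 0" using X(1)[rule_format, of i] assms by auto
      then show ?thesis
        unfolding F_def integral_divide_zero
        by (subst Bochner_Integration.integral_diff)
          (rule integrable_levy_one_minus_exp assms refl | assumption)+
    qed
    have "(\<lambda>i. LINT t|\<nu>. ((1 - exp (- X i * t)) - (1 - exp (- l * t))) / (X i - l))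
        \<longlonglongrightarrow> (LINT t|\<nu>. t * exp (- l * t))"
    proof (rule integral_dominated_convergence)
      show "integrable \<nu> (\<lambda>t. (1 + 1 / (l / 2)) * min 1 t)"
        using assms by (intro integrable_levy[where C = "1 + 1 / (l / 2)"])
          (auto simp: abs_mult)
      show "AE t in \<nu>. (\<lambda>i. ((1 - exp (- X i * t)) - (1 - exp (- l * t))) / (X i - l))
          \<longlonglongrightarrow> t * exp (- l * t)"
      proof (rule AE_I2)
        fix t :: real
        have "((\<lambda>y. 1 - exp (- y * t)) has_field_derivative t * exp (- l * t)) (at l)"
          by (auto intro!: derivative_eq_intros)
        then have "((\<lambda>y. ((1 - exp (- y * t)) - (1 - exp (- l * t))) / (y - l)) \<longlongrightarrow> t * exp (- l * t)) (at l)"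
          by (simp add: has_field_derivative_iff)
        then have "((\<lambda>y. ((1 - exp (- y * t)) - (1 - exp (- l * t))) / (y - l))
            \<circ> X) \<longlonglongrightarrow> t * exp (- l * t)"
          using X unfolding tendsto_at_iff_sequentially by blast
        then show "(\<lambda>i. ((1 - exp (- X i * t)) - (1 - exp (- l * t))) / (X i - l))
            \<longlonglongrightarrow> t * exp (- l * t)"
          by (simp add: o_def)
      qed
      show "AE t in \<nu>. norm (((1 - exp (- X i * t)) - (1 - exp (- l * t))) / (X i - l))
          \<le> (1 + 1 / (l / 2)) * min 1 t" for i
        using AE_levy_pos
      proof (rule eventually_mono)
        fix t :: real assume "t > 0"
        then show "norm (((1 - exp (- X i * t)) - (1 - exp (- l * t))) / (X i - l))
          \<le> (1 + 1 / (l / 2)) * min 1 t"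
          unfolding real_norm_def
          using X(1)[rule_format, of i] assms by (intro exp_minus_quotient_bound) auto
      qed
    qed measurable
    then show "((\<lambda>y. (F y - F l) / (y - l)) \<circ> X) \<longlonglongrightarrow> (LINT t|\<nu>. t * exp (- l * t))"
      by (simp only: eq o_def)
  qed
  moreover have "at l within {l/2<..} = at l"
    using assms by (intro at_within_open) auto
  ultimately show ?thesis
    by (simp add: has_field_derivative_iff F_def)
qed

end

section \<open>Uniqueness of the exponent and measurability of the density\<close>

text \<open>Time \<open>t = 1\<close> suffices, by injectivity of \<open>exp\<close>. This carries
  the derivative of the explicit representation over to \<phi>.\<close>

lemma is_laplace_exponent_unique:
  assumes "is_laplace_exponent M S \<phi>" "is_laplace_exponent M S \<psi>" "l > 0"
  shows "\<phi> l = \<psi> l"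
proof -
  have "exp (- 1 * \<phi> l) = exp (- 1 * \<psi> l)"
    using assms unfolding is_laplace_exponent_def by (metis zero_le_one)
  then show ?thesis by simp
qed

text \<open>Measurability of the density comes from monotonicity: its negative is increasing on the
  half-line, and the indicator extends it by 0.\<close>

lemma borel_measurable_antimono_on_Ioi:
  fixes \<mu> :: "real \<Rightarrow> real"
  assumes "antimono_on {0<..} \<mu>"
  shows "(\<lambda>t. indicator {0<..} t * \<mu> t) \<in> borel_measurable borel"
proof -
  have "mono_on {0<..} (\<lambda>t. - \<mu> t)"
    using assms by (auto simp: monotone_on_def)
  then have "(\<lambda>t. - \<mu> t) \<in> borel_measurable (restrict_space borel {0<..})"
    by (intro borel_measurable_mono_on_fnc) auto
  then have "(\<lambda>t. - (- \<mu> t)) \<in> borel_measurable (restrict_space borel {0<..})"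
    by (rule borel_measurable_uminus)
  then show ?thesis
    by (subst (asm) borel_measurable_restrict_space_iff) auto
qed

section \<open>Estimates for a decreasing Levy density\<close>

context
  fixes \<nu> :: "real measure" and \<mu> :: "real \<Rightarrow> real"
  assumes \<nu>: "\<nu> = density lborel (\<lambda>t. indicator {0<..} t * ennreal (\<mu> t))"
    and min_fin: "(\<integral>\<^sup>+t. ennreal (min 1 t) \<partial>\<nu>) < \<infinity>"
    and null: "emeasure \<nu> {..0} = 0"
    and \<mu>_nonneg: "\<And>t. t > 0 \<Longrightarrow> \<mu> t \<ge> 0"
    and \<mu>_anti: "antimono_on {0<..} \<mu>"
begin

text \<open>Puts the indicator inside \<open>ennreal\<close>, as the Bochner integral rules for real
  densities require.\<close>

lemma density_levy_eq: "\<nu> = density lborel (\<lambda>t. ennreal (indicator {0<..} t * \<mu> t))"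
  unfolding \<nu> by (rule arg_cong[where f = "density lborel"]) (auto simp: indicator_def)

lemma lebesgue_integral_levy:
  assumes "f \<in> borel_measurable borel"
  shows "(LINT t|\<nu>. f t) = (LINT t|lborel. indicator {0<..} t * \<mu> t * f t)"
    and "integrable \<nu> f \<longleftrightarrow> integrable lborel (\<lambda>t. indicator {0<..} t * \<mu> t * f t)"
  using assms \<mu>_nonneg borel_measurable_antimono_on_Ioi[OF \<mu>_anti] unfolding density_levy_eq
  by (auto simp: integral_density integrable_density indicator_def)

lemma integrable_levy_density:
  assumes "l > 0"
  shows "integrable lborel (\<lambda>t. indicator {0<..} t * \<mu> t * (t * exp (- l * t)))"
proof -
  have "sets \<nu> = sets borel" by (simp add: \<nu>)
  from integrable_levy_times_exp[OF this null min_fin assms] show ?thesis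
    by (subst (asm) lebesgue_integral_levy) auto
qed

text \<open>Where the integral diverges, its default value 0 agrees with the claim.\<close>

lemma levy_laplace_nonneg: "(LINT t|\<nu>. t * exp (- l * t)) \<ge> 0"
  using \<mu>_nonneg
  by (subst lebesgue_integral_levy) (auto intro!: Bochner_Integration.integral_nonneg simp: indicator_def)

lemma levy_laplace_antimono:
  assumes "0 < l" "l \<le> l'"
  shows "(LINT t|\<nu>. t * exp (- l' * t)) \<le> (LINT t|\<nu>. t * exp (- l * t))"
proof -
  have "(LINT t|lborel. indicator {0<..} t * \<mu> t * (t * exp (- l' * t)))
      \<le> (LINT t|lborel. indicator {0<..} t * \<mu> t * (t * exp (- l * t)))"
    using assms \<mu>_nonneg
    by (intro integral_mono integrable_levy_density)
      (auto simp: indicator_def intro!: mult_left_mono mult_right_mono)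
  then show ?thesis
    by (simp add: lebesgue_integral_levy)
qed

lemma levy_density_upper:
  assumes "s > 0"
  shows "\<mu> s * s\<^sup>2 / (4 * exp 1) \<le> (LINT t|\<nu>. t * exp (- (inverse s) * t))"
proof -
  \<comment> \<open>A lower bound for the integrand on \<open>[s/2, s]\<close>: there
    \<open>\<mu> t \<ge> \<mu> s\<close>, \<open>t \<ge> s/2\<close> and
    \<open>exp (- t/s) \<ge> exp (- 1)\<close>. The interval length \<open>s/2\<close> gives the
    other factor.\<close>
  define K where "K = \<mu> s * (s / 2 * exp (- 1))"
  have "(LINT t|lborel. indicator {s/2..s} t * K)
      \<le> (LINT t|lborel. indicator {0<..} t * \<mu> t * (t * exp (- (inverse s) * t)))"
  proof (rule integral_mono)
    show "integrable lborel (\<lambda>t. indicator {s/2..s} t * K)"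
      using assms by (auto intro!: integrable_mult_left integrable_real_indicator)
    show "integrable lborel (\<lambda>t. indicator {0<..} t * \<mu> t * (t * exp (- (inverse s) * t)))"
      using assms by (intro integrable_levy_density) auto
    fix t
    show "indicator {s/2..s} t * K \<le> indicator {0<..} t * \<mu> t * (t * exp (- (inverse s) * t))"
    proof (cases "t \<in> {s/2..s}")
      case True
      then have t: "t > 0" using assms by auto
      have "\<mu> s \<le> \<mu> t" using \<mu>_anti True t assms by (auto simp: monotone_on_def)
      moreover have "exp (- 1) \<le> exp (- (inverse s) * t)"
        using True assms by (simp add: field_simps)
      ultimately have "K \<le> \<mu> t * (t * exp (- (inverse s) * t))"
        unfolding K_def using True t assms \<mu>_nonneg[of t] \<mu>_nonneg[of s]
        by (intro mult_mono) auto
      then show ?thesis using True t by simp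
    next
      case False
      then show ?thesis using \<mu>_nonneg[of t] by (auto simp: indicator_def)
    qed
  qed
  moreover have "(LINT t|lborel. indicator {s/2..s} t * K) = \<mu> s * s\<^sup>2 / (4 * exp 1)"
    using assms by (simp add: K_def exp_minus field_simps power2_eq_square)
  ultimately show ?thesis
    by (simp add: lebesgue_integral_levy)
qed

lemma levy_laplace_split:
  assumes "l > 0" "r > 0"
  shows "(LINT t|\<nu>. t * exp (- l * t))
    \<le> exp 1 * (LINT t|\<nu>. t * exp (- (inverse r) * t)) + \<mu> r / l\<^sup>2"
proof -
  let ?f = "\<lambda>l t. indicator {0<..} t * \<mu> t * (t * exp (- l * t))"
  \<comment> \<open>For \<open>t > 0\<close> this density is \<open>l^2 * t * exp (- l * t)\<close>
    (index 1 is the power of \<open>t\<close>). Its total mass 1 says that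
    \<open>t * exp (- l * t)\<close> integrates to \<open>1 / l^2\<close> over the
    half-line.\<close>
  interpret erlang: prob_space "density lborel (erlang_density 1 l)"
    using assms by (intro prob_space_erlang_density)
  have erlang_int: "integrable lborel (erlang_density 1 l)"
    and erlang_1: "(LINT t|lborel. erlang_density 1 l t) = 1"
  proof -
    have 1: "(\<integral>\<^sup>+t. ennreal (erlang_density 1 l t) \<partial>lborel) = ennreal 1"
      using erlang.emeasure_space_1 by (simp add: emeasure_density)
    have nn: "\<And>t. 0 \<le> erlang_density 1 l t" using assms by (simp add: erlang_density_nonneg)
    have "has_bochner_integral lborel (erlang_density 1 l) 1"
      using nn 1 by (intro has_bochner_integral_nn_integral) auto
    then show "integrable lborel (erlang_density 1 l)" "(LINT t|lborel. erlang_density 1 l t) = 1"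
      by (auto simp: has_bochner_integral_iff)
  qed
  have "(LINT t|lborel. ?f l t)
      \<le> (LINT t|lborel. exp 1 * ?f (inverse r) t + \<mu> r / l\<^sup>2 * erlang_density 1 l t)"
  proof (rule integral_mono)
    show "integrable lborel (?f l)"
      using assms by (intro integrable_levy_density)
    show "integrable lborel (\<lambda>t. exp 1 * ?f (inverse r) t + \<mu> r / l\<^sup>2 * erlang_density 1 l t)"
      using assms erlang_int
      by (intro Bochner_Integration.integrable_add integrable_mult_right integrable_levy_density) auto
    fix t
    have E: "\<mu> r / l\<^sup>2 * erlang_density 1 l t = \<mu> r * (t * exp (- l * t))" if "t > 0"
      using that assms by (simp add: erlang_density_def power2_eq_square)
    \<comment> \<open>Lets the Erlang term be dropped when \<open>t \<le> r\<close>.\<close>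
    have nn: "0 \<le> \<mu> r / l\<^sup>2 * erlang_density 1 l t"
      using assms \<mu>_nonneg[of r] by (simp add: erlang_density_nonneg)
    consider "t \<le> 0" | "0 < t" "t \<le> r" | "r < t" by linarith
    then show "?f l t \<le> exp 1 * ?f (inverse r) t + \<mu> r / l\<^sup>2 * erlang_density 1 l t"
    proof cases
      case 1
      then show ?thesis using nn by simp
    next
      case 2
      \<comment> \<open>For \<open>t \<le> r\<close> the left exponent is at most 0 and the right
        one at least 0; the 1 becomes the factor \<open>exp 1\<close>.\<close>
      have "exp (- l * t) \<le> exp (1 + - inverse r * t)"
      proof -
        have "- l * t \<le> 0" using 2 assms by simp
        moreover have "inverse r * t \<le> 1" using 2 assms by (simp add: field_simps)
        ultimately show ?thesis by simp
      qed
      then have "?f l t \<le> \<mu> t * (t * exp (1 + - inverse r * t))"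
        using 2 \<mu>_nonneg[of t] by (auto intro!: mult_left_mono)
      also have "\<dots> = exp 1 * ?f (inverse r) t"
        using 2 by (simp only: exp_add) simp
      finally show ?thesis using nn by linarith
    next
      case 3
      then have t: "t > 0" using assms by simp
      have "\<mu> t \<le> \<mu> r" using \<mu>_anti 3 assms by (auto simp: monotone_on_def)
      then have "?f l t \<le> \<mu> r * (t * exp (- l * t))"
        using t by (auto intro!: mult_right_mono)
      moreover have "0 \<le> exp 1 * ?f (inverse r) t"
        using t \<mu>_nonneg[of t] by simp
      ultimately show ?thesis using E[OF t] by linarith
    qed
  qed
  also have "\<dots> = exp 1 * (LINT t|lborel. ?f (inverse r) t) + \<mu> r / l\<^sup>2"
  proof -
    have "integrable lborel (?f (inverse r))"
      using assms by (intro integrable_levy_density) auto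
    then show ?thesis
      using erlang_int erlang_1
      by (subst Bochner_Integration.integral_add)
        (auto simp del: mult_minus_left times_divide_eq_left simp: integral_mult_right_zero)
  qed
  finally show ?thesis
    by (simp add: lebesgue_integral_levy)
qed

end

section \<open>The two-sided bound near zero\<close>

theorem proposition3p2:
  fixes M :: "'a measure" and S :: "real \<Rightarrow> 'a \<Rightarrow> real"
    and \<phi> \<mu> :: "real \<Rightarrow> real" and \<nu> :: "real measure" and \<alpha> :: real
  assumes "0 \<le> \<alpha>" and "\<alpha> < 2"
    and "subordinator M S"
    and "is_laplace_exponent M S \<phi>"
    and "\<And>x. x > 0 \<Longrightarrow>
           ((\<lambda>l. deriv \<phi> (l * x) / deriv \<phi> l) \<longlongrightarrow> x powr (\<alpha> / 2 - 1)) at_top"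
    and "subordinator_levy_measure_of M S \<nu>"
    and "emeasure \<nu> (space \<nu>) = \<infinity>"
    and "\<nu> = density lborel (\<lambda>t. indicator {0<..} t * ennreal (\<mu> t))"
    and "\<And>t. t > 0 \<Longrightarrow> \<mu> t \<ge> 0"
    and "antimono_on {0<..} \<mu>"
  shows "\<exists>c>0. \<exists>C>0. \<forall>\<^sub>F t in at_right 0.
           c \<le> \<mu> t / (t powi (-2) * deriv \<phi> (inverse t)) \<and>
           \<mu> t / (t powi (-2) * deriv \<phi> (inverse t)) \<le> C"
proof -
  obtain \<gamma> where sets_\<nu>: "sets \<nu> = sets borel" and null: "emeasure \<nu> {..0} = 0"
    and min_fin: "(\<integral>\<^sup>+t. ennreal (min 1 t) \<partial>\<nu>) < \<infinity>" and \<gamma>: "\<gamma> \<ge> 0"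
    and exponent: "is_laplace_exponent M S (\<lambda>l. \<gamma> * l + (LINT t|\<nu>. 1 - exp (- l * t)))"
    using assms(6) unfolding subordinator_levy_measure_of_def by blast
  define D where "D = deriv \<phi>"
  define T where "T = (\<lambda>l. LINT t|\<nu>. t * exp (- l * t))"
  note density = assms(8) min_fin null assms(9,10)
  \<comment> \<open>\<phi> agrees with the representation on the open half-line, so the derivatives
    agree there.\<close>
  have D: "D l = \<gamma> + T l" if "l > 0" for l
  proof -
    have "((\<lambda>l. \<gamma> * l + (LINT t|\<nu>. 1 - exp (- l * t))) has_field_derivative \<gamma> + T l) (at l)"
      unfolding T_def
      by (rule derivative_eq_intros refl levy_integral_has_derivative[OF sets_\<nu> null min_fin that])+ simp
    then have "(\<phi> has_field_derivative \<gamma> + T l) (at l)"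
      by (rule has_field_derivative_transform_within_open[where S = "{0<..}"])
        (use that is_laplace_exponent_unique[OF exponent assms(4)] in auto)
    then show ?thesis unfolding D_def by (rule DERIV_imp_deriv)
  qed
  have T_nonneg: "T l \<ge> 0" for l
    unfolding T_def using levy_laplace_nonneg[OF density] .
  have D_antimono: "D l' \<le> D l" if "0 < l" "l \<le> l'" for l l'
    using D[of l] D[of l'] that levy_laplace_antimono[OF density that] by (simp add: T_def)
  have upper: "\<mu> s * s\<^sup>2 / (4 * exp 1) \<le> D (inverse s)" if "s > 0" for s
    using D[of "inverse s"] \<gamma> that levy_density_upper[OF density that] by (simp add: T_def)
  have split: "D l \<le> exp 1 * D (inverse r) + \<mu> r / l\<^sup>2" if "l > 0" "r > 0" for l r
  proof -
    \<comment> \<open>The drift of \<open>D l\<close> is absorbed into that of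
      \<open>exp 1 * D (inverse r)\<close>.\<close>
    have "1 * \<gamma> \<le> exp 1 * \<gamma>"
      using \<gamma> by (intro mult_right_mono) auto
    then show ?thesis
      using D[of l] D[of "inverse r"] that levy_laplace_split[OF density that]
      by (simp add: T_def algebra_simps)
  qed
  have "((\<lambda>x. x powr (\<alpha> / 2 - 1)) \<longlongrightarrow> 0) (at_top :: real filter)"
    using \<open>\<alpha> < 2\<close> by (intro tendsto_neg_powr filterlim_ident) auto
  then have "\<forall>\<^sub>F x::real in at_top. x powr (\<alpha> / 2 - 1) < 1 / (2 * exp 1)"
    by (rule order_tendstoD) simp
  then obtain N :: real where N: "\<And>x. x \<ge> N \<Longrightarrow> x powr (\<alpha> / 2 - 1) < 1 / (2 * exp 1)"
    unfolding eventually_at_top_linorder by metis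
  \<comment> \<open>\<open>x \<ge> N\<close> makes the limiting ratio small;
    \<open>x \<ge> 1\<close> ensures \<open>inverse t / x \<le> inverse t\<close>, as monotonicity
    of \<open>D\<close> will need.\<close>
  define x where "x = max 1 N"
  have x: "x powr (\<alpha> / 2 - 1) < 1 / (2 * exp 1)" "x \<ge> 1"
    using N[of x] by (auto simp: x_def)
  have ev_small: "\<forall>\<^sub>F l in at_top. D (l * x) / D l < 1 / (2 * exp 1)"
    using assms(5)[of x] x unfolding D_def by (intro order_tendstoD) auto
  text \<open>At \<open>x = 1\<close> the junk value \<open>0 / 0 = 0\<close> would contradict the limit \<open>1\<close>.\<close>
  have ev_nonzero: "\<forall>\<^sub>F l in at_top. D (l * 1) / D l > 0"
    using assms(5)[of 1] unfolding D_def by (intro order_tendstoD) auto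
  have lim1: "filterlim inverse at_top (at_right (0::real))"
    by (rule filterlim_inverse_at_top_right)
  have lim2: "filterlim (\<lambda>t. inverse t / x) at_top (at_right 0)"
    unfolding divide_inverse mult.commute[of _ "inverse x"]
    using x by (intro filterlim_tendsto_pos_mult_at_top[OF tendsto_const _ lim1]) simp
  \<comment> \<open>The lower constant is half of \<open>1 / x^2\<close>, from
    \<open>l^2 = 1 / (t * x)^2\<close>; the upper one comes from \<open>upper\<close>.\<close>
  have bounds: "\<forall>\<^sub>F t in at_right 0.
           1 / (2 * x\<^sup>2) \<le> \<mu> t / (t powi (-2) * D (inverse t)) \<and>
           \<mu> t / (t powi (-2) * D (inverse t)) \<le> 4 * exp 1"
    using eventually_compose_filterlim[OF ev_small lim2]
      eventually_compose_filterlim[OF ev_nonzero lim2]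
      eventually_compose_filterlim[OF ev_nonzero lim1] eventually_at_right_less[of 0]
  proof eventually_elim
    case (elim t)
    define l where "l = inverse t / x"
    have l: "l > 0" "l * x = inverse t" "l \<le> inverse t"
      using elim(4) x by (auto simp: l_def field_simps)
    have "D l \<ge> 0" "D (inverse t) \<ge> 0"
      using D \<gamma> T_nonneg l elim(4) by auto
    \<comment> \<open>A zero of \<open>D\<close> would make the ratio \<open>D / D\<close> vanish;
      positivity is needed both at \<open>l\<close> and at \<open>inverse t\<close>.\<close>
    then have pos: "D l > 0" "D (inverse t) > 0"
      using elim(2,3) by (auto simp: l_def order_le_less)
    have "D (inverse t) / D l < 1 / (2 * exp 1)"
      using elim(1) unfolding l_def[symmetric] l(2) .
    then have "exp 1 * D (inverse t) \<le> D l / 2"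
      using pos(1) by (simp add: field_simps)
    \<comment> \<open>Splitting at \<open>r = t\<close> now reads
      \<open>D l \<le> D l / 2 + \<mu> t / l^2\<close>.\<close>
    then have "D l / 2 \<le> \<mu> t / l\<^sup>2"
      using split[OF l(1) elim(4)] by linarith
    then have "D (inverse t) / 2 \<le> \<mu> t / l\<^sup>2"
      using D_antimono[OF l(1,3)] by linarith
    moreover have "\<mu> t / l\<^sup>2 = \<mu> t * t\<^sup>2 * x\<^sup>2"
      using x elim(4) by (simp add: l_def field_simps)
    moreover have "\<mu> t / (t powi (-2) * D (inverse t)) = \<mu> t * t\<^sup>2 / D (inverse t)"
      using elim(4) by (simp add: power_int_minus field_simps)
    moreover have "\<mu> t * t\<^sup>2 \<le> 4 * exp 1 * D (inverse t)"
      using upper[OF elim(4)] by (simp add: field_simps)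
    ultimately have "1 / (2 * x\<^sup>2) \<le> \<mu> t * t\<^sup>2 / D (inverse t)"
      and "\<mu> t * t\<^sup>2 / D (inverse t) \<le> 4 * exp 1"
      and "\<mu> t / (t powi (-2) * D (inverse t)) = \<mu> t * t\<^sup>2 / D (inverse t)"
      using pos x by (simp_all only: pos_divide_le_eq pos_le_divide_eq) (simp_all add: field_simps)
    then show ?case by simp
  qed
  have "1 / (2 * x\<^sup>2) > 0" "4 * exp (1::real) > 0"
    using x by auto
  with bounds show ?thesis
    unfolding D_def by blast
qed

end
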